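(* For $\ell,n\ge 1$ let $M_{n,2,\ell}$ be the number of words $w=w_1\cdots w_n\in\{1,2,\ldots,\ell\}^n$ such that $|w_i-w_{i+1}|\le 2$ for all $1\le i<n$. Then $$1+\sum_{n\ge 1}M_{n,2,6}\,t^n=\frac{1+2t-t^2-t^3}{1-4t-t^2+t^3}$$ and $$1+\sum_{n\ge 1}M_{n,2,7}\,t^n=\frac{1+2t-4t^2-2t^3+2t^4}{1-5t+2t^2+4t^3-2t^4}.$$ *)

theory Defs
  imports "HOL-Computational_Algebra.Formal_Power_Series"
begin

(* Words are lists, so the letter w_i of the paper is w ! (i - 1). The letter
   differences are taken over int, since subtraction on nat truncates. *)
definition smooth_words :: "nat \<Rightarrow> nat \<Rightarrow> nat \<Rightarrow> nat list set" where
  "smooth_words n k l =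
     {w. length w = n \<and> set w \<subseteq> {1..l} \<and>
         (\<forall>i. Suc i < n \<longrightarrow> \<bar>int (w ! i) - int (w ! Suc i)\<bar> \<le> int k)}"

definition M :: "nat \<Rightarrow> nat \<Rightarrow> nat \<Rightarrow> nat" where
  "M n k l = card (smooth_words n k l)"

end

(* Transfer-matrix method. Sorting the nonempty words by their first letter gives
   generating functions that satisfy a linear system over the power series. The reflection
   a |-> l + 1 - a halves the number of unknowns, and what remains is solved by
   elimination: the denominators are the determinants of the reduced systems. *)
theory Submission
  imports Defs
begin

text \<open>The first letter is kept apart, so \<open>n\<close> counts only the letters after
  \<open>a\<close>. The generating function of these counts then has constant term 1.\<close>

definition tails :: "nat \<Rightarrow> nat \<Rightarrow> nat \<Rightarrow> nat \<Rightarrow> nat list set" where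
  "tails k l n a = {w. a # w \<in> smooth_words (Suc n) k l}"

text \<open>The support of row \<open>a\<close> of the transfer matrix.\<close>

definition nbrs :: "nat \<Rightarrow> nat \<Rightarrow> nat \<Rightarrow> nat set" where
  "nbrs k l a = {b \<in> {1..l}. \<bar>int a - int b\<bar> \<le> int k}"

lemma finite_smooth_words: "finite (smooth_words n k l)"
  by (rule finite_subset[OF _ finite_lists_length_eq[of "{1..l}" n]])
     (auto simp: smooth_words_def)

lemma finite_tails: "finite (tails k l n a)"
proof -
  have "(#) a ` tails k l n a \<subseteq> smooth_words (Suc n) k l"
    by (auto simp: tails_def)
  then have "finite ((#) a ` tails k l n a)"
    using finite_smooth_words finite_subset by blast
  then show ?thesis
    by (rule finite_imageD) simp
qed

text \<open>Prepending \<open>a\<close> creates just one new adjacent pair, the first; all others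
  are pairs of \<open>b # w\<close>, shifted by one position.\<close>

lemma Cons_Cons_smooth_words_iff:
  "a # b # w \<in> smooth_words (Suc (Suc n)) k l \<longleftrightarrow>
     a \<in> {1..l} \<and> \<bar>int a - int b\<bar> \<le> int k \<and> b # w \<in> smooth_words (Suc n) k l"
  by (auto simp: smooth_words_def All_less_Suc2 nth_Cons' less_Suc_eq_0_disj)

lemma smooth_words_Suc: "smooth_words (Suc n) k l = (\<Union>a\<in>{1..l}. (#) a ` tails k l n a)"
proof (rule set_eqI)
  fix w
  show "w \<in> smooth_words (Suc n) k l \<longleftrightarrow> w \<in> (\<Union>a\<in>{1..l}. (#) a ` tails k l n a)"
    by (cases w) (auto simp: tails_def smooth_words_def)
qed

lemma tails_Suc:
  assumes "a \<in> {1..l}"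
  shows "tails k l (Suc n) a = (\<Union>b\<in>nbrs k l a. (#) b ` tails k l n b)"
proof (rule set_eqI)
  fix w
  show "w \<in> tails k l (Suc n) a \<longleftrightarrow> w \<in> (\<Union>b\<in>nbrs k l a. (#) b ` tails k l n b)"
  proof (cases w)
    case Nil
    then show ?thesis by (auto simp: tails_def smooth_words_def)
  next
    case (Cons b v)
    \<comment> \<open>\<open>nbrs\<close> asks that \<open>b\<close> be a letter; the splitting of
      the first pair yields this only through the remaining word.\<close>
    have "b # v \<in> smooth_words (Suc n) k l \<Longrightarrow> b \<in> {1..l}"
      by (auto simp: smooth_words_def)
    then show ?thesis
      using assms Cons by (auto simp: tails_def nbrs_def Cons_Cons_smooth_words_iff)
  qed
qed

lemma card_UN_Cons_tails:
  assumes "finite B"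
  shows "card (\<Union>b\<in>B. (#) b ` tails k l n b) = (\<Sum>b\<in>B. card (tails k l n b))"
proof -
  have "card (\<Union>b\<in>B. (#) b ` tails k l n b) = (\<Sum>b\<in>B. card ((#) b ` tails k l n b))"
    using assms finite_tails by (intro card_UN_disjoint) auto
  then show ?thesis by (simp add: card_image)
qed

lemma M_Suc: "M (Suc n) k l = (\<Sum>a\<in>{1..l}. card (tails k l n a))"
  by (simp add: M_def smooth_words_Suc card_UN_Cons_tails)

lemma card_tails_0:
  assumes "a \<in> {1..l}"
  shows "card (tails k l 0 a) = 1"
proof -
  have "tails k l 0 a = {[]}"
    using assms by (auto simp: tails_def smooth_words_def)
  then show ?thesis by simp
qed

lemma card_tails_Suc:
  assumes "a \<in> {1..l}"
  shows "card (tails k l (Suc n) a) = (\<Sum>b\<in>nbrs k l a. card (tails k l n b))"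
  using assms by (simp add: tails_Suc card_UN_Cons_tails nbrs_def)

text \<open>The reflection is an involution of the alphabet that preserves distances, so it maps the
  neighbours of \<open>a\<close> onto those of its mirror image. Induction through the recurrence
  avoids reflecting whole words.\<close>

lemma card_tails_reflect:
  assumes "a \<in> {1..l}"
  shows "card (tails k l n (Suc l - a)) = card (tails k l n a)"
  using assms
proof (induction n arbitrary: a)
  case 0
  then have "Suc l - a \<in> {1..l}" by auto
  with 0 show ?case by (simp only: card_tails_0)
next
  case (Suc n)
  have "(\<Sum>b\<in>nbrs k l (Suc l - a). card (tails k l n b))
      = (\<Sum>b\<in>nbrs k l a. card (tails k l n b))"
  proof (rule sum.reindex_bij_witness[where i = "\<lambda>b. Suc l - b" and j = "\<lambda>b. Suc l - b"])
    fix b assume "b \<in> nbrs k l (Suc l - a)"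
    then show "card (tails k l n (Suc l - b)) = card (tails k l n b)"
      using Suc.IH by (auto simp: nbrs_def)
  \<comment> \<open>On letters the subtraction from \<open>Suc l\<close> does not truncate, so it
    commutes with the passage to \<open>int\<close>.\<close>
  qed (use Suc.prems in \<open>auto simp: nbrs_def of_nat_diff\<close>)
  moreover have "Suc l - a \<in> {1..l}" using Suc.prems by auto
  ultimately show ?case
    using Suc.prems by (simp only: card_tails_Suc)
qed

definition tails_fps :: "nat \<Rightarrow> nat \<Rightarrow> nat \<Rightarrow> 'a::field_char_0 fps" where
  "tails_fps k l a = Abs_fps (\<lambda>n. of_nat (card (tails k l n a)))"

lemma tails_fps_reflect:
  "a \<in> {1..l} \<Longrightarrow> tails_fps k l (Suc l - a) = tails_fps k l a"
  by (simp only: tails_fps_def card_tails_reflect)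

text \<open>One row of the linear system: the 1 is the empty tail, and \<open>fps_X\<close> marks
  the first letter of a nonempty one.\<close>

lemma tails_fps_eq:
  assumes "a \<in> {1..l}"
  shows "tails_fps k l a = 1 + fps_X * (\<Sum>b\<in>nbrs k l a. tails_fps k l b)"
proof (rule fps_ext)
  fix n
  show "fps_nth (tails_fps k l a) n = fps_nth (1 + fps_X * (\<Sum>b\<in>nbrs k l a. tails_fps k l b)) n"
    using card_tails_0[OF assms, of k] card_tails_Suc[OF assms, of k]
    by (cases n) (simp_all add: tails_fps_def fps_sum_nth)
qed

text \<open>The factor \<open>fps_X\<close> restores the first letter, which
  \<open>tails_fps\<close> does not count.\<close>

lemma M_fps_eq:
  "1 + Abs_fps (\<lambda>n. if n \<ge> 1 then of_nat (M n k l) else 0)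
     = 1 + fps_X * (\<Sum>a\<in>{1..l}. tails_fps k l a)"
proof (rule fps_ext)
  fix n
  show "fps_nth (1 + Abs_fps (\<lambda>n. if n \<ge> 1 then of_nat (M n k l) else 0)) n
     = fps_nth (1 + fps_X * (\<Sum>a\<in>{1..l}. tails_fps k l a)) n"
    by (cases n) (simp_all add: tails_fps_def fps_sum_nth M_Suc)
qed

text \<open>Clears the denominator, leaving a polynomial identity over a commutative ring.\<close>

lemma fps_eq_divideI:
  fixes F :: "'a::field fps"
  assumes "F * D = N" and "fps_nth D 0 \<noteq> 0"
  shows "F = N / D"
proof -
  have "D \<noteq> 0" using assms(2) by auto
  then show ?thesis using assms(1) by auto
qed

lemma M_2_6_fps:
  "1 + Abs_fps (\<lambda>n. if n \<ge> 1 then of_nat (M n 2 6) else 0) =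
     (1 + 2 * fps_X - fps_X ^ 2 - fps_X ^ 3) /
     (1 - 4 * fps_X - fps_X ^ 2 + fps_X ^ 3 :: 'a::field_char_0 fps)"
proof (rule fps_eq_divideI)
  define g :: "nat \<Rightarrow> 'a fps" where "g = tails_fps 2 6"
  \<comment> \<open>The letters 1, 2, 3 represent the orbits {1,6}, {2,5}, {3,4} of the reflection,
    so three rows suffice.\<close>
  have nbrs: "nbrs 2 6 1 = {1,2,3}" "nbrs 2 6 2 = {1,2,3,4}" "nbrs 2 6 3 = {1,2,3,4,5}"
    by (auto simp: nbrs_def)
  have refl: "g 6 = g 1" "g 5 = g 2" "g 4 = g 3"
    using tails_fps_reflect[of 1 6 2] tails_fps_reflect[of 2 6 2] tails_fps_reflect[of 3 6 2]
    by (simp_all add: g_def)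
  have e1: "g 1 = 1 + fps_X * (g 1 + g 2 + g 3)"
    using tails_fps_eq[of 1 6 2, where 'a = 'a, folded g_def, unfolded nbrs]
    by (simp add: algebra_simps)
  \<comment> \<open>Coefficients 2 arise where a letter and its mirror image are both neighbours,
    here 3 and 4.\<close>
  have e2: "g 2 = 1 + fps_X * (g 1 + g 2 + 2 * g 3)"
    using tails_fps_eq[of 2 6 2, where 'a = 'a, folded g_def, unfolded nbrs]
    by (simp add: refl algebra_simps)
  have e3: "g 3 = 1 + fps_X * (g 1 + 2 * g 2 + 2 * g 3)"
    using tails_fps_eq[of 3 6 2, where 'a = 'a, folded g_def, unfolded nbrs]
    by (simp add: refl algebra_simps)
  have "{1..6::nat} = {1,2,3,4,5,6}" by auto
  then have "(\<Sum>a\<in>{1..6}. g a) = 2 * (g 1 + g 2 + g 3)"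
    by (simp add: refl algebra_simps)
  then have "1 + Abs_fps (\<lambda>n. if n \<ge> 1 then of_nat (M n 2 6) else 0)
      = 1 + 2 * fps_X * (g 1 + g 2 + g 3)"
    by (simp only: M_fps_eq g_def mult_ac)
  \<comment> \<open>The cubic is the determinant of the system \<open>e1\<close>, \<open>e2\<close>,
    \<open>e3\<close>. By Cramer's rule its product with each unknown is a polynomial, so the goal
    is a polynomial combination of the equations.\<close>
  then show "(1 + Abs_fps (\<lambda>n. if n \<ge> 1 then of_nat (M n 2 6) else 0))
      * (1 - 4 * fps_X - fps_X ^ 2 + fps_X ^ 3 :: 'a fps)
      = 1 + 2 * fps_X - fps_X ^ 2 - fps_X ^ 3"
    using e1 e2 e3 by algebra
qed simp

lemma M_2_7_fps:
  "1 + Abs_fps (\<lambda>n. if n \<ge> 1 then of_nat (M n 2 7) else 0) =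
     (1 + 2 * fps_X - 4 * fps_X ^ 2 - 2 * fps_X ^ 3 + 2 * fps_X ^ 4) /
     (1 - 5 * fps_X + 2 * fps_X ^ 2 + 4 * fps_X ^ 3 - 2 * fps_X ^ 4 :: 'a::field_char_0 fps)"
proof (rule fps_eq_divideI)
  define g :: "nat \<Rightarrow> 'a fps" where "g = tails_fps 2 7"
  \<comment> \<open>Here the middle letter 4 is its own mirror image: it gives a fourth unknown,
    which enters the total only once.\<close>
  have nbrs: "nbrs 2 7 1 = {1,2,3}" "nbrs 2 7 2 = {1,2,3,4}" "nbrs 2 7 3 = {1,2,3,4,5}"
    "nbrs 2 7 4 = {2,3,4,5,6}"
    by (auto simp: nbrs_def)
  have refl: "g 7 = g 1" "g 6 = g 2" "g 5 = g 3"
    using tails_fps_reflect[of 1 7 2] tails_fps_reflect[of 2 7 2] tails_fps_reflect[of 3 7 2]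
    by (simp_all add: g_def)
  have e1: "g 1 = 1 + fps_X * (g 1 + g 2 + g 3)"
    using tails_fps_eq[of 1 7 2, where 'a = 'a, folded g_def, unfolded nbrs]
    by (simp add: algebra_simps)
  have e2: "g 2 = 1 + fps_X * (g 1 + g 2 + g 3 + g 4)"
    using tails_fps_eq[of 2 7 2, where 'a = 'a, folded g_def, unfolded nbrs]
    by (simp add: algebra_simps)
  have e3: "g 3 = 1 + fps_X * (g 1 + g 2 + 2 * g 3 + g 4)"
    using tails_fps_eq[of 3 7 2, where 'a = 'a, folded g_def, unfolded nbrs]
    by (simp add: refl algebra_simps)
  have e4: "g 4 = 1 + fps_X * (2 * g 2 + 2 * g 3 + g 4)"
    using tails_fps_eq[of 4 7 2, where 'a = 'a, folded g_def, unfolded nbrs]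
    by (simp add: refl algebra_simps)
  have "{1..7::nat} = {1,2,3,4,5,6,7}" by auto
  then have "(\<Sum>a\<in>{1..7}. g a) = 2 * (g 1 + g 2 + g 3) + g 4"
    by (simp add: refl algebra_simps)
  then have "1 + Abs_fps (\<lambda>n. if n \<ge> 1 then of_nat (M n 2 7) else 0)
      = 1 + fps_X * (2 * (g 1 + g 2 + g 3) + g 4)"
    by (simp only: M_fps_eq g_def)
  \<comment> \<open>As for six letters, now with the quartic determinant of \<open>e1\<close> to
    \<open>e4\<close>.\<close>
  then show "(1 + Abs_fps (\<lambda>n. if n \<ge> 1 then of_nat (M n 2 7) else 0))
      * (1 - 5 * fps_X + 2 * fps_X ^ 2 + 4 * fps_X ^ 3 - 2 * fps_X ^ 4 :: 'a fps)
      = 1 + 2 * fps_X - 4 * fps_X ^ 2 - 2 * fps_X ^ 3 + 2 * fps_X ^ 4"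
    using e1 e2 e3 e4 by algebra
qed simp

theorem mainTheorem12:
  "1 + Abs_fps (\<lambda>n. if n \<ge> 1 then of_nat (M n 2 6) else 0) =
     ((1 + 2 * fps_X - fps_X ^ 2 - fps_X ^ 3) /
      (1 - 4 * fps_X - fps_X ^ 2 + fps_X ^ 3) :: rat fps)
   \<and>
   1 + Abs_fps (\<lambda>n. if n \<ge> 1 then of_nat (M n 2 7) else 0) =
     ((1 + 2 * fps_X - 4 * fps_X ^ 2 - 2 * fps_X ^ 3 + 2 * fps_X ^ 4) /
      (1 - 5 * fps_X + 2 * fps_X ^ 2 + 4 * fps_X ^ 3 - 2 * fps_X ^ 4) :: rat fps)"
  using M_2_6_fps M_2_7_fps by blast

end
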